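(* Let $n,k,m$ be non-negative integers, let $\mathfrak p\in G[n]\backslash \mathrm{GL}(\infty)/G[k]$ and $\mathfrak q\in G[k]\backslash \mathrm{GL}(\infty)/G[m]$, and let $p\in\mathfrak p$, $q\in\mathfrak q$ be representatives. Then the double coset $G[n]\,p\,\Theta_j[k]\,q\,G[m]$ is the same for all sufficiently large $j$, and this eventual value does not depend on the choice of the representatives $p\in\mathfrak p$ and $q\in\mathfrak q$. Hence $$\mathfrak p\star_t\mathfrak q = G[n]\,p\,\Theta_j[k]\,q\,G[m]\quad (j\text{ sufficiently large})$$ is a well-defined element of $G[n]\backslash \mathrm{GL}(\infty)/G[m]$. Moreover, this operation is associative: for all non-negative integers $n,k,m,l$ and all $\mathfrak a\in G[n]\backslash \mathrm{GL}(\infty)/G[k]$, $\mathfrak b\in G[k]\backslash \mathrm{GL}(\infty)/G[m]$, $\mathfrak c\in G[m]\backslash \mathrm{GL}(\infty)/G[l]$, one has $(\mathfrak a\star_t\mathfrak b)\star_t\mathfrak c=\mathfrak a\star_t(\mathfrak b\star_t\mathfrak c)$.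
   Context: $\mathrm{GL}(n)$ denotes $\mathrm{GL}(n,\mathbb Z[t,t^{-1}])$, and $\mathrm{GL}(\infty)$ is the direct limit of the groups $\mathrm{GL}(n)$ under $T\mapsto\begin{pmatrix}T&0\\0&1\end{pmatrix}$; its elements are invertible infinite matrices (rows and columns indexed by the positive integers) that differ from the identity matrix in only finitely many entries. Let $v=(1,t,t^2,\dots)$ and $u=(1,1,1,\dots)$, regarded as infinite column vectors, with $v^{\rm T}$ the transpose of $v$. For a non-negative integer $n$, $$G[n]=\left\{\begin{pmatrix}1_n&0\\0&X\end{pmatrix} : X\in \mathrm{GL}(\infty),\ v^{\rm T}X=v^{\rm T},\ Xu=u\right\},$$ a subgroup of $\mathrm{GL}(\infty)$. For subgroups $K,L$ of a group $H$, $K\backslash H/L$ denotes the set of double cosets $KhL$, $h\in H$. For integers $j\geq 1$, $k\ge 0$, $$\Theta_j[k]=\begin{pmatrix}1_k&0&0&0\\0&V_j&t^j1_j&0\\0&1_j&0&0\\0&0&0&1_\infty\end{pmatrix},\qquad V_j=(1-t)\begin{pmatrix}1&t&\cdots&t^{j-1}\\ \vdots&\vdots&\ddots&\vdots\\1&t&\cdots&t^{j-1}\end{pmatrix},$$ where $V_j$ is $j\times j$ with all rows equal, and $1_r$ is the identity matrix of size $r$. *)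

theory Defs
  imports "HOL-Algebra.Coset" "HOL-Library.Poly_Mapping"
begin

text \<open>
  The ring of Laurent polynomials over the integers is the group ring of the additive group
  of integers: finitely supported functions from exponents to coefficients, with convolution.
\<close>

type_synonym laurent = "int \<Rightarrow>\<^sub>0 int"

definition t :: laurent where
  "t = Poly_Mapping.single 1 1"

text \<open>
  Rows and columns of infinite matrices are indexed from 0, so the entry with indices
  \<open>i\<close>, \<open>j\<close> below is the one with indices \<open>i + 1\<close>, \<open>j + 1\<close> in the usual numbering.
\<close>

type_synonym inf_vec = "nat \<Rightarrow> laurent"
type_synonym inf_mat = "nat \<Rightarrow> nat \<Rightarrow> laurent"

definition one_mat :: inf_mat where
  "one_mat i j = (if i = j then 1 else 0)"

text \<open>
  \<open>Sum_any\<close> sums over the support of the summand and is 0 if that support is infinite. For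
  matrices that differ from the identity in finitely many entries, every row and
  every column has finite support, so this does not occur below.
\<close>

definition mat_mult :: "inf_mat \<Rightarrow> inf_mat \<Rightarrow> inf_mat" where
  "mat_mult A B i j = Sum_any (\<lambda>k. A i k * B k j)"

definition vec_mat :: "inf_vec \<Rightarrow> inf_mat \<Rightarrow> inf_vec" where
  "vec_mat x A j = Sum_any (\<lambda>i. x i * A i j)"

definition mat_vec :: "inf_mat \<Rightarrow> inf_vec \<Rightarrow> inf_vec" where
  "mat_vec A x i = Sum_any (\<lambda>j. A i j * x j)"

definition finitary_mats :: "inf_mat monoid" where
  "finitary_mats =
    \<lparr>carrier = {A. finite {(i, j). A i j \<noteq> one_mat i j}}, mult = mat_mult, one = one_mat\<rparr>"

text \<open>
  A matrix and its inverse that both differ from the identity in finitely many entries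
  are stabilizations of mutually inverse \<open>n \<times> n\<close> matrices for a common \<open>n\<close>; hence the units
  form the direct limit of the groups \<open>GL(n)\<close>.
\<close>

definition GL_inf :: "inf_mat monoid" where
  "GL_inf = units_of finitary_mats"

text \<open>The block diagonal matrix with blocks \<open>1\<^sub>n\<close> and \<open>X\<close>.\<close>

definition pad :: "nat \<Rightarrow> inf_mat \<Rightarrow> inf_mat" where
  "pad n X i j = (if i < n \<or> j < n then one_mat i j else X (i - n) (j - n))"

definition v :: inf_vec where
  "v i = t ^ i"

definition u :: inf_vec where
  "u i = 1"

definition G :: "nat \<Rightarrow> inf_mat set" where
  "G n = {pad n X | X. X \<in> carrier GL_inf \<and> vec_mat v X = v \<and> mat_vec X u = u}"

text \<open>
  The entries of \<open>\<Theta>\<^sub>j[0]\<close>, read off from its blocks; rows and columns \<open>0..<j\<close>, \<open>j..<2*j\<close>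
  and \<open>2*j..\<close> correspond to the last three block rows and columns of \<open>\<Theta>\<^sub>j[k]\<close>.
\<close>

definition Theta0 :: "nat \<Rightarrow> inf_mat" where
  "Theta0 j a b =
    (if a < j then
       (if b < j then (1 - t) * t ^ b
        else if b = a + j then t ^ j else 0)
     else if a < 2 * j then
       (if a = b + j then 1 else 0)
     else one_mat a b)"

definition Theta :: "nat \<Rightarrow> nat \<Rightarrow> inf_mat" where
  "Theta j k = pad k (Theta0 j)"

definition double_coset :: "('a, 'b) monoid_scheme \<Rightarrow> 'a set \<Rightarrow> 'a \<Rightarrow> 'a set \<Rightarrow> 'a set" where
  "double_coset H K h L = (K #>\<^bsub>H\<^esub> h) <#>\<^bsub>H\<^esub> L"

definition double_cosets :: "('a, 'b) monoid_scheme \<Rightarrow> 'a set \<Rightarrow> 'a set \<Rightarrow> 'a set set" where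
  "double_cosets H K L = {double_coset H K h L | h. h \<in> carrier H}"

text \<open>The double coset \<open>G[n] p \<Theta>\<^sub>j[k] q G[m]\<close>.\<close>

definition Theta_coset ::
    "nat \<Rightarrow> nat \<Rightarrow> nat \<Rightarrow> inf_mat \<Rightarrow> inf_mat \<Rightarrow> nat \<Rightarrow> inf_mat set" where
  "Theta_coset n k m p q j =
    double_coset GL_inf (G n) (p \<otimes>\<^bsub>GL_inf\<^esub> Theta j k \<otimes>\<^bsub>GL_inf\<^esub> q) (G m)"

definition star :: "nat \<Rightarrow> nat \<Rightarrow> nat \<Rightarrow> inf_mat set \<Rightarrow> inf_mat set \<Rightarrow> inf_mat set" where
  "star n k m P Q =
    (THE D. \<forall>p\<in>P. \<forall>q\<in>Q. eventually (\<lambda>j. Theta_coset n k m p q j = D) sequentially)"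

end

theory Submission
  imports Defs
begin

text \<open>
  The matrix \<open>\<Theta>\<^sub>j\<close> is the square case of rectangular block exchanges \<open>\<Theta>\<^sub>a\<^sub>,\<^sub>b\<close>, the images of the
  braids in which a ribbon of \<open>a\<close> strands crosses one of \<open>b\<close> strands. Splitting a ribbon gives
  \<open>\<Theta>\<^sub>a\<^sub>+\<^sub>c\<^sub>,\<^sub>b = \<Theta>\<^sub>a\<^sub>,\<^sub>b diag(1\<^sub>a, \<Theta>\<^sub>c\<^sub>,\<^sub>b)\<close> and \<open>\<Theta>\<^sub>a\<^sub>,\<^sub>b\<^sub>+\<^sub>c = diag(1\<^sub>b, \<Theta>\<^sub>a\<^sub>,\<^sub>c) \<Theta>\<^sub>a\<^sub>,\<^sub>b\<close>.
  If \<open>p\<close> lives in the first \<open>k + b\<close> and \<open>q\<close> in the first \<open>k + a\<close> coordinates, the additional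
  factors commute with \<open>p\<close> and \<open>q\<close> and are absorbed by the outer groups, so the double coset of
  \<open>p \<Theta>\<^sub>a\<^sub>,\<^sub>b[k] q\<close> no longer changes when \<open>a\<close> and \<open>b\<close> grow. Elements of \<open>G[k]\<close> between \<open>p\<close> and \<open>q\<close>
  slide through \<open>\<Theta>\<^sub>j\<close> to the far side, because \<open>V\<^sub>j\<close> is a multiple of \<open>u v\<^sup>T\<close>, and are absorbed as well.
  For \<open>x\<close>, \<open>y\<close>, \<open>z\<close> in the first \<open>N\<close> coordinates, \<open>\<alpha> = N - k\<close> and \<open>\<delta> = N - m\<close>, associativity is
  witnessed by the equality
  \<open>x \<Theta>\<^sub>\<alpha>\<^sub>,\<^sub>\<alpha>[k] y \<Theta>\<^sub>\<delta>\<^sub>,\<^sub>\<delta>\<^sub>+\<^sub>\<alpha>[m] z = x \<Theta>\<^sub>\<alpha>\<^sub>+\<^sub>\<delta>\<^sub>,\<^sub>\<alpha>[k] y \<Theta>\<^sub>\<delta>\<^sub>,\<^sub>\<delta>[m] z\<close>.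
\<close>

subsection \<open>Finitary matrices\<close>

text \<open>An explicit, enlargeable bound: matrices sharing one act as square matrices of that
  size, which turns \<open>Sum_any\<close> into sums over \<open>{..<n}\<close>.\<close>

definition supp_below :: "nat \<Rightarrow> inf_mat \<Rightarrow> bool" where
  "supp_below n A \<longleftrightarrow> (\<forall>i j. A i j \<noteq> one_mat i j \<longrightarrow> i < n \<and> j < n)"

lemma supp_below_eq: "supp_below n A \<Longrightarrow> n \<le> i \<or> n \<le> j \<Longrightarrow> A i j = one_mat i j"
  unfolding supp_below_def using linorder_not_less by blast

lemma supp_below_mono: "supp_below n A \<Longrightarrow> n \<le> m \<Longrightarrow> supp_below m A"
  unfolding supp_below_def by (meson order_less_le_trans)

lemma one_mat_simps [simp]: "one_mat i i = 1" "i \<noteq> j \<Longrightarrow> one_mat i j = 0"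
  by (simp_all add: one_mat_def)

lemma supp_below_one [simp]: "supp_below n one_mat"
  by (simp add: supp_below_def)

lemma finitary_iff_supp_below: "A \<in> carrier finitary_mats \<longleftrightarrow> (\<exists>n. supp_below n A)"
proof
  assume "A \<in> carrier finitary_mats"
  then have fin: "finite {(i, j). A i j \<noteq> one_mat i j}" (is "finite ?S")
    by (simp add: finitary_mats_def)
  then obtain n1 n2 where n: "\<forall>i\<in>fst ` ?S. i < n1" "\<forall>j\<in>snd ` ?S. j < n2"
    by (meson finite_imageI finite_nat_set_iff_bounded)
  have "supp_below (max n1 n2) A"
    unfolding supp_below_def using n by (force simp: less_max_iff_disj)
  then show "\<exists>n. supp_below n A" ..
next
  assume "\<exists>n. supp_below n A"
  then obtain n where "supp_below n A" ..
  then have "{(i, j). A i j \<noteq> one_mat i j} \<subseteq> {..<n} \<times> {..<n}"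
    by (auto simp: supp_below_def)
  then show "A \<in> carrier finitary_mats"
    by (simp add: finitary_mats_def finite_subset)
qed

lemma mat_vec_eq:
  assumes "supp_below n A"
  shows "mat_vec A x i = (if i < n then (\<Sum>j<n. A i j * x j) else x i)"
proof (cases "i < n")
  case True
  then have "A i j = 0" if "n \<le> j" for j
    using supp_below_eq[OF assms, of i j] that by simp
  then have "{j. A i j * x j \<noteq> 0} \<subseteq> {..<n}"
    by (auto simp: not_le[symmetric])
  then show ?thesis
    using True by (simp add: mat_vec_def Sum_any.expand_superset[of "{..<n}"])
next
  case False
  then have row: "A i j = one_mat i j" for j
    using supp_below_eq[OF assms] by simp
  then have "{j. A i j * x j \<noteq> 0} \<subseteq> {i}"
    by (auto simp: one_mat_def)
  then show ?thesis
    using False row by (simp add: mat_vec_def Sum_any.expand_superset[of "{i}"])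
qed

lemma vec_mat_eq:
  assumes "supp_below n A"
  shows "vec_mat x A j = (if j < n then (\<Sum>i<n. x i * A i j) else x j)"
proof (cases "j < n")
  case True
  then have "A i j = 0" if "n \<le> i" for i
    using supp_below_eq[OF assms, of i j] that by simp
  then have "{i. x i * A i j \<noteq> 0} \<subseteq> {..<n}"
    by (auto simp: not_le[symmetric])
  then show ?thesis
    using True by (simp add: vec_mat_def Sum_any.expand_superset[of "{..<n}"])
next
  case False
  then have col: "A i j = one_mat i j" for i
    using supp_below_eq[OF assms] by simp
  then have "{i. x i * A i j \<noteq> 0} \<subseteq> {j}"
    by (auto simp: one_mat_def)
  then show ?thesis
    using False col by (simp add: vec_mat_def Sum_any.expand_superset[of "{j}"])
qed

lemma mat_mult_eq_mat_vec: "mat_mult A B i j = mat_vec A (\<lambda>k. B k j) i"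
  by (simp add: mat_mult_def mat_vec_def)

lemma supp_below_mult:
  assumes "supp_below n A" "supp_below n B"
  shows "supp_below n (mat_mult A B)"
proof -
  have "mat_mult A B i j = one_mat i j" if "\<not> (i < n \<and> j < n)" for i j
  proof (cases "i < n")
    case True
    with that have "n \<le> j" by simp
    moreover have "k < n \<Longrightarrow> B k j = 0" for k
      using supp_below_eq[OF assms(2), of k j] \<open>n \<le> j\<close> by simp
    ultimately show ?thesis
      using True by (simp add: mat_mult_eq_mat_vec mat_vec_eq[OF assms(1)])
  next
    case False
    then show ?thesis
      using supp_below_eq[OF assms(2), of i j]
      by (simp add: mat_mult_eq_mat_vec mat_vec_eq[OF assms(1)])
  qed
  then show ?thesis by (auto simp: supp_below_def)
qed

lemma mat_vec_mult_bounded: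
  assumes "supp_below n A" "supp_below n B"
  shows "mat_vec (mat_mult A B) x = mat_vec A (mat_vec B x)"
proof
  fix i
  have "mat_vec (mat_mult A B) x i = mat_vec A (mat_vec B x) i" if "i < n"
  proof -
    have "mat_vec (mat_mult A B) x i = (\<Sum>j<n. \<Sum>k<n. A i k * B k j * x j)"
      using that
      by (simp add: mat_vec_eq[OF supp_below_mult[OF assms]] mat_mult_eq_mat_vec
          mat_vec_eq[OF assms(1)] sum_distrib_right)
    also have "\<dots> = (\<Sum>k<n. \<Sum>j<n. A i k * B k j * x j)"
      by (rule sum.swap)
    also have "\<dots> = mat_vec A (mat_vec B x) i"
      using that
      by (simp add: mat_vec_eq[OF assms(1)] mat_vec_eq[OF assms(2)] sum_distrib_left mult.assoc)
    finally show ?thesis .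
  qed
  then show "mat_vec (mat_mult A B) x i = mat_vec A (mat_vec B x) i"
    using mat_vec_eq[OF supp_below_mult[OF assms]] mat_vec_eq[OF assms(1)]
      mat_vec_eq[OF assms(2)] by (cases "i < n") auto
qed

lemma vec_mat_mult_bounded:
  assumes "supp_below n A" "supp_below n B"
  shows "vec_mat x (mat_mult A B) = vec_mat (vec_mat x A) B"
proof
  fix j
  have "vec_mat x (mat_mult A B) j = vec_mat (vec_mat x A) B j" if "j < n"
  proof -
    have "vec_mat x (mat_mult A B) j = (\<Sum>i<n. \<Sum>k<n. x i * A i k * B k j)"
      using that
      by (simp add: vec_mat_eq[OF supp_below_mult[OF assms]] mat_mult_eq_mat_vec
          mat_vec_eq[OF assms(1)] sum_distrib_left mult.assoc)
    also have "\<dots> = (\<Sum>k<n. \<Sum>i<n. x i * A i k * B k j)"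
      by (rule sum.swap)
    also have "\<dots> = vec_mat (vec_mat x A) B j"
      using that
      by (simp add: vec_mat_eq[OF assms(1)] vec_mat_eq[OF assms(2)] sum_distrib_right)
    finally show ?thesis .
  qed
  then show "vec_mat x (mat_mult A B) j = vec_mat (vec_mat x A) B j"
    using vec_mat_eq[OF supp_below_mult[OF assms]] vec_mat_eq[OF assms(1)]
      vec_mat_eq[OF assms(2)] by (cases "j < n") auto
qed

lemma finitary_common_bound:
  assumes "A \<in> carrier finitary_mats" "B \<in> carrier finitary_mats"
  obtains n where "supp_below n A" "supp_below n B"
proof -
  obtain a b where "supp_below a A" "supp_below b B"
    using assms by (auto simp: finitary_iff_supp_below)
  then show thesis
    using that[of "max a b"] supp_below_mono by simp
qed

lemma finitary_mult_closed:
  "A \<in> carrier finitary_mats \<Longrightarrow> B \<in> carrier finitary_mats \<Longrightarrow>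
    mat_mult A B \<in> carrier finitary_mats"
  by (metis finitary_common_bound finitary_iff_supp_below supp_below_mult)

lemma mat_vec_mult:
  "A \<in> carrier finitary_mats \<Longrightarrow> B \<in> carrier finitary_mats \<Longrightarrow>
    mat_vec (mat_mult A B) x = mat_vec A (mat_vec B x)"
  by (metis finitary_common_bound mat_vec_mult_bounded)

lemma vec_mat_mult:
  "A \<in> carrier finitary_mats \<Longrightarrow> B \<in> carrier finitary_mats \<Longrightarrow>
    vec_mat x (mat_mult A B) = vec_mat (vec_mat x A) B"
  by (metis finitary_common_bound vec_mat_mult_bounded)

lemma mat_vec_one [simp]: "mat_vec one_mat x = x"
  using mat_vec_eq[of 0 one_mat] by auto

lemma vec_mat_one [simp]: "vec_mat x one_mat = x"
  using vec_mat_eq[of 0 one_mat] by auto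

text \<open>
  Identities between finitary matrices are checked below on the operators that they induce on
  sequences, where multiplication becomes composition.
\<close>

lemma mat_eqI:
  assumes "\<And>x. mat_vec A x = mat_vec B x"
  shows "A = B"
proof (intro ext)
  fix i j
  \<comment> \<open>Column \<open>j\<close> of \<open>one_mat\<close> is the unit vector at
    \<open>j\<close>. Applying \<open>C\<close> to it gives a sum supported at the single index
    \<open>j\<close>, whatever the rows of \<open>C\<close> look like.\<close>
  have unit: "mat_vec C (\<lambda>k. one_mat k j) i = C i j" for C
  proof -
    have "{k. C i k * one_mat k j \<noteq> 0} \<subseteq> {j}"
      by (auto simp: one_mat_def)
    then show ?thesis
      by (simp add: mat_vec_def Sum_any.expand_superset[of "{j}"])
  qed
  show "A i j = B i j"
    using assms unit by metis
qed

lemma one_finitary [simp]: "one_mat \<in> carrier finitary_mats"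
  using finitary_iff_supp_below supp_below_one by blast

lemma finitary_sel [simp]: "mult finitary_mats = mat_mult" "one finitary_mats = one_mat"
  by (simp_all add: finitary_mats_def)

lemma finitary_monoid: "Group.monoid finitary_mats"
proof (rule monoidI)
  fix A B C
  assume ABC: "A \<in> carrier finitary_mats" "B \<in> carrier finitary_mats" "C \<in> carrier finitary_mats"
  have "mat_mult (mat_mult A B) C = mat_mult A (mat_mult B C)"
    by (rule mat_eqI) (simp add: ABC mat_vec_mult finitary_mult_closed)
  then show "A \<otimes>\<^bsub>finitary_mats\<^esub> B \<otimes>\<^bsub>finitary_mats\<^esub> C =
      A \<otimes>\<^bsub>finitary_mats\<^esub> (B \<otimes>\<^bsub>finitary_mats\<^esub> C)"
    by simp
qed (auto simp: finitary_mult_closed mat_vec_mult intro!: mat_eqI)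

subsection \<open>Double cosets and the group \<open>GL(\<infinity>)\<close>\<close>

lemma (in group) mem_double_coset_iff:
  "y \<in> double_coset G K h L \<longleftrightarrow> (\<exists>k\<in>K. \<exists>l\<in>L. y = k \<otimes> h \<otimes> l)"
  by (auto simp: double_coset_def r_coset_def set_mult_def)

lemma (in group) double_coset_subset:
  assumes "subgroup K G" "subgroup L G" "k \<in> K" "l \<in> L" "h \<in> carrier G"
  shows "double_coset G K (k \<otimes> h \<otimes> l) L \<subseteq> double_coset G K h L"
proof
  fix y
  assume "y \<in> double_coset G K (k \<otimes> h \<otimes> l) L"
  then obtain k' l' where y: "k' \<in> K" "l' \<in> L" "y = k' \<otimes> (k \<otimes> h \<otimes> l) \<otimes> l'"
    by (auto simp: mem_double_coset_iff)
  then have "y = (k' \<otimes> k) \<otimes> h \<otimes> (l \<otimes> l')"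
    using assms subgroup.mem_carrier by (simp add: m_assoc subgroup.mem_carrier)
  then show "y \<in> double_coset G K h L"
    using assms y by (meson mem_double_coset_iff subgroup.m_closed)
qed

text \<open>One inclusion is \<open>double_coset_subset\<close>; the other is the same lemma applied
  to \<open>inv k\<close> and \<open>inv l\<close>, which recover \<open>h\<close>.\<close>

lemma (in group) double_coset_absorb:
  assumes KL: "subgroup K G" "subgroup L G" and kl: "k \<in> K" "l \<in> L" and h: "h \<in> carrier G"
  shows "double_coset G K (k \<otimes> h \<otimes> l) L = double_coset G K h L"
proof
  have carr: "k \<in> carrier G" "l \<in> carrier G"
    using KL kl subgroup.mem_carrier by metis+
  have "inv k \<otimes> (k \<otimes> h \<otimes> l) \<otimes> inv l = h"
    using carr h by (simp add: m_assoc) (simp add: m_assoc[symmetric])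
  then show "double_coset G K h L \<subseteq> double_coset G K (k \<otimes> h \<otimes> l) L"
    using double_coset_subset[OF KL, of "inv k" "inv l" "k \<otimes> h \<otimes> l"] carr h KL kl
    by (simp add: subgroup.m_inv_closed)
qed (rule double_coset_subset[OF assms])

interpretation GL: group GL_inf
  unfolding GL_inf_def by (rule monoid.units_group[OF finitary_monoid])

lemma GL_sel [simp]: "mult GL_inf = mat_mult" "one GL_inf = one_mat"
  by (simp_all add: GL_inf_def units_of_def)

lemma GL_finitary: "A \<in> carrier GL_inf \<Longrightarrow> A \<in> carrier finitary_mats"
  by (auto simp: GL_inf_def units_of_def Units_def)

lemma GL_I:
  assumes "A \<in> carrier finitary_mats" "B \<in> carrier finitary_mats"
    and "mat_mult A B = one_mat" "mat_mult B A = one_mat"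
  shows "A \<in> carrier GL_inf"
  using assms by (auto simp: GL_inf_def units_of_def Units_def)

lemma GL_supp_below: "A \<in> carrier GL_inf \<Longrightarrow> \<exists>n. supp_below n A"
  using GL_finitary finitary_iff_supp_below by blast

lemma GL_mult_closed [simp, intro]:
  "A \<in> carrier GL_inf \<Longrightarrow> B \<in> carrier GL_inf \<Longrightarrow> mat_mult A B \<in> carrier GL_inf"
  using GL.m_closed by simp

lemma GL_assoc:
  "A \<in> carrier GL_inf \<Longrightarrow> B \<in> carrier GL_inf \<Longrightarrow> C \<in> carrier GL_inf \<Longrightarrow>
    mat_mult (mat_mult A B) C = mat_mult A (mat_mult B C)"
  using GL.m_assoc by simp

lemma mat_vec_mult_GL:
  "A \<in> carrier GL_inf \<Longrightarrow> B \<in> carrier GL_inf \<Longrightarrow>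
    mat_vec (mat_mult A B) x = mat_vec A (mat_vec B x)"
  by (simp add: GL_finitary mat_vec_mult)

section \<open>Padding by an identity block\<close>

lemma supp_below_pad: "supp_below n X \<Longrightarrow> supp_below (k + n) (pad k X)"
proof (unfold supp_below_def, intro allI impI)
  fix i j
  assume n: "\<forall>i j. X i j \<noteq> one_mat i j \<longrightarrow> i < n \<and> j < n" and "pad k X i j \<noteq> one_mat i j"
  then have "k \<le> i" "k \<le> j" "X (i - k) (j - k) \<noteq> one_mat (i - k) (j - k)"
    by (auto simp: pad_def one_mat_def split: if_splits)
  with n have "i - k < n \<and> j - k < n"
    by blast
  with \<open>k \<le> i\<close> \<open>k \<le> j\<close> show "i < k + n \<and> j < k + n"
    by linarith
qed

lemma pad_finitary: "X \<in> carrier finitary_mats \<Longrightarrow> pad k X \<in> carrier finitary_mats"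
  using finitary_iff_supp_below supp_below_pad by blast

lemma pad_pad [simp]: "pad k (pad l X) = pad (k + l) X"
  by (intro ext) (auto simp: pad_def one_mat_def)

lemma pad_one [simp]: "pad k one_mat = one_mat"
  by (intro ext) (auto simp: pad_def one_mat_def)

lemma sum_lessThan_add:
  "(\<Sum>i<a + b. f i) = (\<Sum>i<a. f i) + (\<Sum>i<b. f (a + i :: nat))" for f :: "nat \<Rightarrow> laurent"
  by (induction b) (simp_all add: add.assoc)

lemma sum_one_mat [simp]:
  "(\<Sum>j<n. one_mat i j * x j) = (if i < n then x i else 0)"
  "(\<Sum>j<n. x j * one_mat j i) = (if i < n then x i else 0)"
  by (simp_all add: one_mat_def if_distrib[of "\<lambda>c. c * _"] if_distrib[of "\<lambda>c. _ * c"] cong: if_cong)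

lemma mat_vec_pad:
  assumes "X \<in> carrier finitary_mats"
  shows "mat_vec (pad k X) x i = (if i < k then x i else mat_vec X (\<lambda>j. x (k + j)) (i - k))"
proof -
  obtain n where n: "supp_below n X"
    using assms finitary_iff_supp_below by blast
  show ?thesis
    by (auto simp: mat_vec_eq[OF n] mat_vec_eq[OF supp_below_pad[OF n]] sum_lessThan_add pad_def)
qed

lemma vec_mat_pad:
  assumes "X \<in> carrier finitary_mats"
  shows "vec_mat x (pad k X) i = (if i < k then x i else vec_mat (\<lambda>j. x (k + j)) X (i - k))"
proof -
  obtain n where n: "supp_below n X"
    using assms finitary_iff_supp_below by blast
  show ?thesis
    by (auto simp: vec_mat_eq[OF n] vec_mat_eq[OF supp_below_pad[OF n]] sum_lessThan_add pad_def)
qed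

lemma pad_mult:
  assumes "X \<in> carrier finitary_mats" "Y \<in> carrier finitary_mats"
  shows "pad k (mat_mult X Y) = mat_mult (pad k X) (pad k Y)"
  by (rule mat_eqI, rule ext)
    (auto simp: assms mat_vec_mult mat_vec_pad pad_finitary finitary_mult_closed)

lemma pad_GL [simp, intro]:
  assumes "X \<in> carrier GL_inf"
  shows "pad k X \<in> carrier GL_inf"
proof -
  obtain Y where "Y \<in> carrier GL_inf" and "mat_mult X Y = one_mat" "mat_mult Y X = one_mat"
    using assms GL.r_inv GL.l_inv GL.inv_closed by (metis GL_sel)
  then show ?thesis
    using assms GL_finitary
    by (intro GL_I[of _ "pad k Y"]) (auto simp: pad_finitary simp flip: pad_mult)
qed

text \<open>The two factors act on disjoint sets of coordinates, those below \<open>n\<close> and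
  those from \<open>n\<close> on.\<close>

lemma mult_pad_commute:
  assumes A: "supp_below n A" "A \<in> carrier GL_inf" and X: "X \<in> carrier GL_inf"
  shows "mat_mult A (pad n X) = mat_mult (pad n X) A"
proof (intro mat_eqI ext)
  fix x i
  show "mat_vec (mat_mult A (pad n X)) x i = mat_vec (mat_mult (pad n X) A) x i"
    by (auto simp: mat_vec_mult_GL A X mat_vec_pad GL_finitary mat_vec_eq[OF A(1)])
qed

lemma mult_pad_commute':
  assumes "supp_below l A" "l \<le> n" "A \<in> carrier GL_inf" "X \<in> carrier GL_inf"
  shows "mat_mult A (pad n X) = mat_mult (pad n X) A"
  using assms mult_pad_commute supp_below_mono by blast

subsection \<open>Block exchanges\<close>

text \<open>Rows split as \<open>b + a\<close>, columns as \<open>a + b\<close>. For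
  \<open>a = b = 1\<close> the nontrivial block is the Burau matrix with rows
  \<open>(1 - t, t)\<close> and \<open>(1, 0)\<close>.\<close>

definition Theta_rect :: "nat \<Rightarrow> nat \<Rightarrow> inf_mat" where
  "Theta_rect a b i j =
    (if i < b then
       (if j < a then (1 - t) * t ^ j
        else if j = a + i then t ^ a else 0)
     else if i < a + b then
       (if i = j + b then 1 else 0)
     else one_mat i j)"

lemma Theta0_eq_rect: "Theta0 j = Theta_rect j j"
  by (intro ext) (auto simp: Theta0_def Theta_rect_def)

lemma supp_below_Theta_rect: "supp_below (a + b) (Theta_rect a b)"
  unfolding supp_below_def Theta_rect_def by (auto simp: one_mat_def split: if_splits)

lemma sum_if_zero [simp]:
  "(\<Sum>j<n. (if j = i then c j else 0) * x j) = (if i < n then c i * x i else 0)"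
  for x c :: "nat \<Rightarrow> laurent" and i :: nat
  by (simp add: if_distrib[of "\<lambda>c. c * _"] cong: if_cong)

text \<open>The top left block has equal rows, so all of the first \<open>b\<close> outputs share
  one scalar, the \<open>v\<close>-weighted sum of the first \<open>a\<close> inputs. The relations
  below come from following this scalar.\<close>

lemma mat_vec_Theta_rect:
  "mat_vec (Theta_rect a b) x i =
    (if i < b then (1 - t) * (\<Sum>c<a. v c * x c) + t ^ a * x (a + i)
     else if i < a + b then x (i - b) else x i)"
proof -
  consider "i < b" | "b \<le> i" "i < a + b" | "a + b \<le> i"
    by linarith
  then show ?thesis
  proof cases
    case 1
    then have "mat_vec (Theta_rect a b) x i =
        (\<Sum>j<a. (1 - t) * t ^ j * x j) + (\<Sum>j<b. (if j = i then t ^ a else 0) * x (a + j))"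
      by (simp add: mat_vec_eq[OF supp_below_Theta_rect] sum_lessThan_add Theta_rect_def)
    also have "\<dots> = (1 - t) * (\<Sum>c<a. v c * x c) + t ^ a * x (a + i)"
      using 1 sum_if_zero[of i "\<lambda>_. t ^ a" "\<lambda>j. x (a + j)" b]
      by (simp add: v_def sum_distrib_left mult.assoc)
    finally show ?thesis
      using 1 by simp
  next
    case 2
    then have "mat_vec (Theta_rect a b) x i = (\<Sum>j<a + b. (if i = j + b then 1 else 0) * x j)"
      by (auto simp: mat_vec_eq[OF supp_below_Theta_rect] Theta_rect_def)
    also have "\<dots> = (\<Sum>j<a + b. (if j = i - b then 1 else 0) * x j)"
      using 2 by (intro sum.cong refl) auto
    also have "\<dots> = x (i - b)"
      using 2 by (subst sum_if_zero) auto
    finally show ?thesis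
      using 2 by simp
  next
    case 3
    then show ?thesis
      by (simp add: mat_vec_eq[OF supp_below_Theta_rect])
  qed
qed

text \<open>The factor \<open>Poly_Mapping.single (- int a) 1\<close> is \<open>t\<close> to the power \<open>-a\<close>.\<close>

definition Theta_rect_inv :: "nat \<Rightarrow> nat \<Rightarrow> inf_mat" where
  "Theta_rect_inv a b i j =
    (if i < a then (if j = b + i then 1 else 0)
     else if i < a + b then
       (if j < b then (if j = i - a then Poly_Mapping.single (- int a) 1 else 0)
        else if j < a + b then - (Poly_Mapping.single (- int a) 1 * (1 - t) * t ^ (j - b)) else 0)
     else one_mat i j)"

lemma supp_below_Theta_rect_inv: "supp_below (b + a) (Theta_rect_inv a b)"
  unfolding supp_below_def Theta_rect_inv_def by (auto simp: one_mat_def split: if_splits)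

lemma t_power_inverse: "Poly_Mapping.single (- int a) 1 * t ^ a = 1"
proof -
  have "t ^ a = Poly_Mapping.single (int a) 1"
    by (induction a) (simp_all add: t_def mult_single)
  then show ?thesis
    by (simp add: mult_single)
qed

text \<open>This solves the equations of \<open>mat_vec_Theta_rect\<close>: the lower outputs return
  the first \<open>a\<close> inputs, hence the common scalar; subtracting it and dividing by
  \<open>t ^ a\<close> gives the others.\<close>

lemma mat_vec_Theta_rect_inv:
  "mat_vec (Theta_rect_inv a b) x i =
    (if i < a then x (b + i)
     else if i < a + b then Poly_Mapping.single (- int a) 1 *
       (x (i - a) - (1 - t) * (\<Sum>c<a. v c * x (b + c)))
     else x i)"
proof -
  let ?s = "Poly_Mapping.single (- int a) 1 :: laurent"
  consider "i < a" | "a \<le> i" "i < a + b" | "a + b \<le> i"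
    by linarith
  then show ?thesis
  proof cases
    case 1
    then have "mat_vec (Theta_rect_inv a b) x i = (\<Sum>j<b + a. (if j = b + i then 1 else 0) * x j)"
      by (auto simp: mat_vec_eq[OF supp_below_Theta_rect_inv] Theta_rect_inv_def intro!: sum.cong)
    with 1 show ?thesis
      using sum_if_zero[of "b + i" "\<lambda>_. 1" x "b + a"] by auto
  next
    case 2
    then have "mat_vec (Theta_rect_inv a b) x i =
        (\<Sum>j<b. (if j = i - a then ?s else 0) * x j) +
        (\<Sum>j<a. - (?s * (1 - t) * t ^ j) * x (b + j))"
      by (simp add: mat_vec_eq[OF supp_below_Theta_rect_inv] sum_lessThan_add Theta_rect_inv_def)
    also have "\<dots> = ?s * x (i - a) - ?s * ((1 - t) * (\<Sum>c<a. v c * x (b + c)))"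
      using 2 sum_if_zero[of "i - a" "\<lambda>_. ?s" x b]
      by (simp add: v_def sum_distrib_left sum_negf mult.assoc less_diff_conv2)
    finally show ?thesis
      using 2 by (simp add: right_diff_distrib)
  next
    case 3
    then show ?thesis
      by (simp add: mat_vec_eq[OF supp_below_Theta_rect_inv])
  qed
qed

lemma Theta_rect_GL [simp, intro]: "Theta_rect a b \<in> carrier GL_inf"
proof (rule GL_I)
  show fin: "Theta_rect a b \<in> carrier finitary_mats" "Theta_rect_inv a b \<in> carrier finitary_mats"
    using finitary_iff_supp_below supp_below_Theta_rect supp_below_Theta_rect_inv by blast+
  have inv: "t ^ a * (Poly_Mapping.single (- int a) 1 * y) = y"
    "Poly_Mapping.single (- int a) 1 * (t ^ a * y) = y" for y
    using t_power_inverse[of a] by (metis mult.assoc mult.commute mult_1)+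
  show "mat_mult (Theta_rect a b) (Theta_rect_inv a b) = one_mat"
    by (rule mat_eqI, rule ext)
      (auto simp: mat_vec_mult fin mat_vec_Theta_rect mat_vec_Theta_rect_inv inv)
  show "mat_mult (Theta_rect_inv a b) (Theta_rect a b) = one_mat"
    by (rule mat_eqI, rule ext)
      (auto simp: mat_vec_mult fin mat_vec_Theta_rect mat_vec_Theta_rect_inv inv less_diff_conv2)
qed

lemma Theta_rect_finitary [simp]: "Theta_rect a b \<in> carrier finitary_mats"
  by (simp add: GL_finitary)

section \<open>Splitting and sliding relations\<close>

text \<open>The \<open>v\<close>-weighted sum over \<open>a + a'\<close> inputs breaks at
  \<open>a\<close>, and its tail carries the factor \<open>t ^ a\<close> that the top right block of
  \<open>Theta_rect a b\<close> supplies.\<close>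

lemma Theta_rect_add_left:
  "Theta_rect (a + a') b = mat_mult (Theta_rect a b) (pad a (Theta_rect a' b))"
proof (intro mat_eqI ext)
  fix x i
  consider "i < b" | "b \<le> i" "i < a + b" | "a + b \<le> i" "i < a + a' + b" | "a + a' + b \<le> i"
    by linarith
  then show "mat_vec (Theta_rect (a + a') b) x i =
      mat_vec (mat_mult (Theta_rect a b) (pad a (Theta_rect a' b))) x i"
    by cases
      (simp_all add: mat_vec_mult_GL mat_vec_Theta_rect mat_vec_pad sum_lessThan_add v_def
        power_add sum_distrib_left less_diff_conv2 algebra_simps)
qed

text \<open>\<open>Theta_rect a b\<close> copies the first \<open>a\<close> inputs to the positions
  from \<open>b\<close> on, where the second factor finds them and forms the same scalar for
  \<open>b'\<close> further rows.\<close>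

lemma Theta_rect_add_right:
  "Theta_rect a (b + b') = mat_mult (pad b (Theta_rect a b')) (Theta_rect a b)"
proof (intro mat_eqI ext)
  fix x i
  consider "i < b" | "b \<le> i" "i < b + b'" | "b + b' \<le> i" "i < a + b + b'" | "a + b + b' \<le> i"
    by linarith
  then show "mat_vec (Theta_rect a (b + b')) x i =
      mat_vec (mat_mult (pad b (Theta_rect a b')) (Theta_rect a b)) x i"
    by cases
      (simp_all add: mat_vec_mult_GL mat_vec_Theta_rect mat_vec_pad less_diff_conv2 algebra_simps)
qed

text \<open>Fixing \<open>u\<close> means that rows sum to 1, so \<open>X\<close> passes the common
  scalar through unchanged and acts only on the inputs shifted by \<open>a\<close>.\<close>

lemma mult_Theta_rect_left:
  assumes X: "supp_below b X" "X \<in> carrier GL_inf" "mat_vec X u = u"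
  shows "mat_mult X (Theta_rect a b) = mat_mult (Theta_rect a b) (pad a X)"
proof (intro mat_eqI ext)
  fix x i
  have row: "(\<Sum>j<b. X i j) = 1" if "i < b"
    using fun_cong[OF X(3), of i] that by (simp add: mat_vec_eq[OF X(1)] u_def)
  have "(\<Sum>j<b. X i j * (c + t ^ a * x (a + j))) =
      c + t ^ a * (\<Sum>j<b. X i j * x (a + j))" if "i < b" for c
    using row[OF that]
    by (simp add: distrib_left sum.distrib sum_distrib_left mult.left_commute flip: sum_distrib_right)
  then show "mat_vec (mat_mult X (Theta_rect a b)) x i =
      mat_vec (mat_mult (Theta_rect a b) (pad a X)) x i"
    using X by (auto simp: mat_vec_mult_GL mat_vec_Theta_rect mat_vec_pad GL_finitary
        mat_vec_eq[OF X(1)])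
qed

text \<open>Dual to the previous relation: fixing \<open>v\<close> preserves the
  \<open>v\<close>-weighted sum, so \<open>X\<close> is visible only in the copied inputs.\<close>

lemma mult_Theta_rect_right:
  assumes X: "supp_below a X" "X \<in> carrier GL_inf" "vec_mat v X = v"
  shows "mat_mult (Theta_rect a b) X = mat_mult (pad b X) (Theta_rect a b)"
proof (intro mat_eqI ext)
  fix x i
  have "(\<Sum>c<a. v c * mat_vec X x c) = (\<Sum>c<a. \<Sum>d<a. v c * X c d * x d)"
    by (simp add: mat_vec_eq[OF X(1)] sum_distrib_left mult.assoc)
  also have "\<dots> = (\<Sum>d<a. \<Sum>c<a. v c * X c d * x d)"
    by (rule sum.swap)
  also have "\<dots> = (\<Sum>d<a. vec_mat v X d * x d)"
    by (simp add: vec_mat_eq[OF X(1)] sum_distrib_right)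
  finally have sum_v: "(\<Sum>c<a. v c * mat_vec X x c) = (\<Sum>c<a. v c * x c)"
    using X(3) by simp
  have high: "mat_vec X y c = y c" if "a \<le> c" for y c
    using that by (simp add: mat_vec_eq[OF X(1)])
  \<comment> \<open>Needed because the output of \<open>Theta_rect a b\<close>, read from position
    \<open>b\<close>, is known to agree with \<open>x\<close> only on the first \<open>a\<close>
    places.\<close>
  have low: "mat_vec X y c = mat_vec X z c" if "c < a" "\<forall>j<a. y j = z j" for y z c
    using that by (simp add: mat_vec_eq[OF X(1)])
  consider "i < b" | "b \<le> i" "i < a + b" | "a + b \<le> i"
    by linarith
  then show "mat_vec (mat_mult (Theta_rect a b) X) x i =
      mat_vec (mat_mult (pad b X) (Theta_rect a b)) x i"
  proof cases
    case 2
    then show ?thesis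
      using X low[of "i - b" x "\<lambda>j. mat_vec (Theta_rect a b) x (b + j)"]
      by (auto simp: mat_vec_mult_GL mat_vec_Theta_rect mat_vec_pad GL_finitary less_diff_conv2)
  qed (use X in \<open>auto simp: mat_vec_mult_GL mat_vec_Theta_rect mat_vec_pad GL_finitary sum_v high\<close>)
qed

subsection \<open>The groups \<open>G[n]\<close>\<close>

lemma G0_iff: "X \<in> G 0 \<longleftrightarrow> X \<in> carrier GL_inf \<and> vec_mat v X = v \<and> mat_vec X u = u"
proof -
  have "pad 0 Y = Y" for Y
    by (simp add: pad_def fun_eq_iff)
  then show ?thesis
    by (auto simp: G_def)
qed

lemma G_eq_pad_image: "G n = pad n ` G 0"
  by (auto simp: G_def[of n] G0_iff)

lemma G0_GL [simp, intro]: "X \<in> G 0 \<Longrightarrow> X \<in> carrier GL_inf"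
  by (simp add: G0_iff)

lemma G_GL [simp, intro]: "X \<in> G n \<Longrightarrow> X \<in> carrier GL_inf"
  by (auto simp: G_eq_pad_image[of n])

lemma G0_mult: "X \<in> G 0 \<Longrightarrow> Y \<in> G 0 \<Longrightarrow> mat_mult X Y \<in> G 0"
  by (auto simp: G0_iff mat_vec_mult vec_mat_mult GL_finitary)

lemma G0_inverse:
  assumes "X \<in> G 0"
  obtains Y where "Y \<in> G 0" "mat_mult X Y = one_mat" "mat_mult Y X = one_mat"
proof -
  obtain Y where Y: "Y \<in> carrier GL_inf" "mat_mult X Y = one_mat" "mat_mult Y X = one_mat"
    using assms GL.r_inv GL.l_inv GL.inv_closed by (metis GL_sel G0_GL)
  \<comment> \<open>Inserting \<open>X\<close> lets it cancel against \<open>Y\<close>, which leaves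
    \<open>v\<close> and \<open>u\<close>.\<close>
  have "vec_mat v Y = vec_mat (vec_mat v X) Y" "mat_vec Y u = mat_vec Y (mat_vec X u)"
    using assms by (simp_all add: G0_iff)
  then have "vec_mat v Y = v" "mat_vec Y u = u"
    using Y assms by (simp_all add: GL_finitary flip: vec_mat_mult mat_vec_mult)
  then show thesis
    using that Y by (simp add: G0_iff)
qed

lemma subgroup_G: "subgroup (G n) GL_inf"
proof (rule GL.subgroupI)
  show "G n \<subseteq> carrier GL_inf"
    by auto
  have "one_mat \<in> G 0"
    using GL.one_closed by (simp add: G0_iff)
  then show "G n \<noteq> {}"
    by (auto simp: G_eq_pad_image[of n])
next
  fix h
  assume "h \<in> G n"
  then obtain X where X: "X \<in> G 0" "h = pad n X"
    by (auto simp: G_eq_pad_image[of n])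
  obtain Y where Y: "Y \<in> G 0" "mat_mult X Y = one_mat" "mat_mult Y X = one_mat"
    using G0_inverse[OF X(1)] by metis
  have "mat_mult (pad n Y) h = one_mat"
    using X Y by (simp add: GL_finitary flip: pad_mult)
  then have "inv\<^bsub>GL_inf\<^esub> h = pad n Y"
    using X Y by (intro GL.inv_equality) auto
  then show "inv\<^bsub>GL_inf\<^esub> h \<in> G n"
    using Y by (auto simp: G_eq_pad_image[of n])
next
  fix h h'
  assume "h \<in> G n" "h' \<in> G n"
  then show "h \<otimes>\<^bsub>GL_inf\<^esub> h' \<in> G n"
    by (auto simp: G_eq_pad_image[of n] GL_finitary G0_mult simp flip: pad_mult)
qed

text \<open>Dropping the first \<open>r\<close> entries multiplies \<open>v\<close> by
  \<open>t ^ r\<close> and leaves \<open>u\<close> alone, so both conditions survive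
  padding.\<close>

lemma pad_G0:
  assumes "X \<in> G 0"
  shows "pad r X \<in> G 0"
proof -
  have X: "X \<in> carrier GL_inf" "vec_mat v X = v" "mat_vec X u = u"
    using assms by (auto simp: G0_iff)
  obtain n where n: "supp_below n X"
    using GL_supp_below X(1) by blast
  have "vec_mat (\<lambda>j. v (r + j)) X j = t ^ r * vec_mat v X j" for j
    by (simp add: vec_mat_eq[OF n] v_def power_add sum_distrib_left mult.assoc)
  then have "vec_mat v (pad r X) = v"
    using X by (auto simp: vec_mat_pad GL_finitary v_def simp flip: power_add)
  moreover have "mat_vec (pad r X) u = u"
  proof
    fix i
    have "(\<lambda>j. u (r + j)) = u"
      by (simp add: u_def fun_eq_iff)
    then show "mat_vec (pad r X) u i = u i"
      using X by (simp add: mat_vec_pad GL_finitary u_def)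
  qed
  ultimately show ?thesis
    using X(1) by (simp add: G0_iff)
qed

text \<open>In other words, the groups \<open>G n\<close> decrease as \<open>n\<close>
  grows.\<close>

lemma pad_G:
  assumes "X \<in> G 0" "n \<le> m"
  shows "pad m X \<in> G n"
proof -
  have "pad n (pad (m - n) X) \<in> G n"
    unfolding G_eq_pad_image[of n] using pad_G0[OF assms(1)] by (rule imageI)
  then show ?thesis
    using assms(2) by simp
qed

text \<open>Both conditions reduce to the geometric sum: a top row sums to
  \<open>(1 - t ^ a) + t ^ a\<close>, and a column \<open>j < a\<close> has weighted sum
  \<open>(1 - t ^ b) * t ^ j + t ^ (b + j)\<close>. Padded block exchanges can therefore be absorbed
  by the outer groups.\<close>

lemma Theta_rect_G0: "Theta_rect a b \<in> G 0"
proof -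
  have geometric: "(1 - t) * (\<Sum>i<n. t ^ i) = 1 - t ^ n" for n
    by (simp add: one_diff_power_eq)
  have "vec_mat v (Theta_rect a b) j = v j" for j
  proof -
    consider "j < a" | i where "j = a + i" "i < b" | "b + a \<le> j"
      by (metis add.commute add_less_cancel_left le_Suc_ex not_le)
    then show ?thesis
    proof cases
      case 1
      then have "vec_mat v (Theta_rect a b) j =
          (\<Sum>i<b. t ^ i * ((1 - t) * t ^ j)) + (\<Sum>i<a. t ^ (b + i) * (if i = j then 1 else 0))"
        by (auto simp: vec_mat_eq[OF supp_below_Theta_rect] add.commute[of a b] sum_lessThan_add
            Theta_rect_def v_def intro!: sum.cong)
      also have "\<dots> = ((1 - t) * (\<Sum>i<b. t ^ i)) * t ^ j + t ^ b * t ^ j"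
        using 1 by (simp add: if_distrib[of "\<lambda>c. _ * c"] power_add sum_distrib_left
            sum_distrib_right mult_ac cong: if_cong)
      finally show ?thesis
        unfolding geometric by (simp add: v_def left_diff_distrib)
    next
      case 2
      then have "vec_mat v (Theta_rect a b) j = (\<Sum>l<b. t ^ l * (if i = l then t ^ a else 0))"
        by (auto simp: vec_mat_eq[OF supp_below_Theta_rect] add.commute[of a b] sum_lessThan_add
            Theta_rect_def v_def intro!: sum.cong)
      also have "\<dots> = v j"
        using 2 by (simp add: if_distrib[of "\<lambda>c. _ * c"] v_def power_add cong: if_cong)
      finally show ?thesis .
    next
      case 3
      then show ?thesis
        by (simp add: vec_mat_eq[OF supp_below_Theta_rect])
    qed
  qed
  moreover have "mat_vec (Theta_rect a b) u = u"
    by (auto simp: mat_vec_Theta_rect u_def v_def geometric)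
  ultimately show ?thesis
    by (auto simp: G0_iff)
qed

lemma mult_pad_left_commute:
  assumes "supp_below l A" "l \<le> n" "A \<in> carrier GL_inf" "X \<in> carrier GL_inf" "B \<in> carrier GL_inf"
  shows "mat_mult A (mat_mult (pad n X) B) = mat_mult (pad n X) (mat_mult A B)"
  using assms mult_pad_commute' GL_assoc pad_GL by metis

lemma double_coset_G_absorb:
  assumes "g \<in> G n" "g' \<in> G m" "h \<in> carrier GL_inf"
  shows "double_coset GL_inf (G n) (mat_mult g (mat_mult h g')) (G m) =
    double_coset GL_inf (G n) h (G m)"
  using GL.double_coset_absorb[OF subgroup_G subgroup_G assms] assms by (simp add: GL_assoc)

lemma mem_double_coset_G_iff:
  assumes "h \<in> carrier GL_inf"
  shows "p \<in> double_coset GL_inf (G n) h (G m) \<longleftrightarrow>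
    (\<exists>g\<in>G n. \<exists>g'\<in>G m. p = mat_mult g (mat_mult h g'))"
  using assms by (auto simp: GL.mem_double_coset_iff GL_assoc intro!: bexI)

subsection \<open>The product of double cosets\<close>

text \<open>The two sizes are independent so that \<open>b\<close> can follow the support of
  \<open>p\<close> and \<open>a\<close> that of \<open>q\<close>.\<close>

definition rect_prod :: "nat \<Rightarrow> nat \<Rightarrow> nat \<Rightarrow> inf_mat \<Rightarrow> inf_mat \<Rightarrow> inf_mat" where
  "rect_prod k a b p q = mat_mult p (mat_mult (pad k (Theta_rect a b)) q)"

lemma rect_prod_GL [simp, intro]:
  "p \<in> carrier GL_inf \<Longrightarrow> q \<in> carrier GL_inf \<Longrightarrow> rect_prod k a b p q \<in> carrier GL_inf"
  by (simp add: rect_prod_def)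

lemma Theta_coset_eq:
  assumes "p \<in> carrier GL_inf" "q \<in> carrier GL_inf"
  shows "Theta_coset n k m p q j = double_coset GL_inf (G n) (rect_prod k j j p q) (G m)"
  using assms by (simp add: Theta_coset_def Theta_def Theta0_eq_rect rect_prod_def GL_assoc)

lemma double_coset_rect_prod_stable:
  assumes p: "p \<in> carrier GL_inf" "supp_below (k + b) p"
    and q: "q \<in> carrier GL_inf" "supp_below (k + a) q"
    and le: "n \<le> k + b" "m \<le> k + a"
  shows "double_coset GL_inf (G n) (rect_prod k (a + a') (b + b') p q) (G m) =
    double_coset GL_inf (G n) (rect_prod k a b p q) (G m)"
proof -
  let ?T = "pad k (Theta_rect a b)"
  \<comment> \<open>Splitting first \<open>b + b'\<close>, then \<open>a + a'\<close>, leaves these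
    two extra factors. \<open>Y\<close> starts past the support of \<open>p\<close> and
    \<open>Z\<close> past that of \<open>q\<close>; \<open>le\<close> puts them in
    \<open>G n\<close> and \<open>G m\<close>.\<close>
  define Y where "Y = pad (k + b) (Theta_rect (a + a') b')"
  define Z where "Z = pad (k + a) (Theta_rect a' b)"
  have YZ: "Y \<in> G n" "Z \<in> G m"
    unfolding Y_def Z_def using le by (simp_all add: pad_G Theta_rect_G0)
  have "pad k (Theta_rect (a + a') (b + b')) = mat_mult Y (mat_mult ?T Z)"
    unfolding Theta_rect_add_right Theta_rect_add_left[of a a' b] Y_def Z_def
    by (simp add: pad_mult GL_finitary)
  then have "rect_prod k (a + a') (b + b') p q = mat_mult p (mat_mult Y (mat_mult ?T (mat_mult Z q)))"
    using YZ p q by (simp add: rect_prod_def GL_assoc)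
  also have "\<dots> = mat_mult Y (mat_mult p (mat_mult ?T (mat_mult Z q)))"
    unfolding Y_def using YZ p q by (intro mult_pad_left_commute[OF p(2)]) auto
  also have "mat_mult Z q = mat_mult q Z"
    unfolding Z_def using q mult_pad_commute by simp
  also have "mat_mult p (mat_mult ?T (mat_mult q Z)) = mat_mult (rect_prod k a b p q) Z"
    using YZ p q by (simp add: rect_prod_def GL_assoc)
  finally show ?thesis
    using YZ p q by (simp add: double_coset_G_absorb)
qed

section \<open>Independence of the representatives\<close>

lemma Theta_coset_rep_change:
  assumes p: "p \<in> carrier GL_inf" and q: "q \<in> carrier GL_inf"
    and g: "g \<in> G n" "g' \<in> G m" and h: "h \<in> G k" "h' \<in> G k"
  shows "\<forall>\<^sub>F j in sequentially.
    Theta_coset n k m (mat_mult g (mat_mult p h)) (mat_mult h' (mat_mult q g')) j =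
    Theta_coset n k m p q j"
proof -
  obtain X X' where X: "X \<in> G 0" "h = pad k X" "X' \<in> G 0" "h' = pad k X'"
    using h by (auto simp: G_eq_pad_image[of k])
  obtain lX lX' lp lq where supp: "supp_below lX X" "supp_below lX' X'" "supp_below lp p" "supp_below lq q"
    using GL_supp_below X p q G0_GL by metis
  have "Theta_coset n k m (mat_mult g (mat_mult p h)) (mat_mult h' (mat_mult q g')) j =
      Theta_coset n k m p q j"
    if j: "lX \<le> j" "lX' \<le> j" "lp \<le> j" "lq \<le> j" "n \<le> j" "m \<le> j" for j
  proof -
    let ?T = "pad k (Theta_rect j j)"
    have T1: "mat_mult h ?T = mat_mult ?T (pad (k + j) X)"
      using mult_Theta_rect_left[of j X j] supp_below_mono[OF supp(1) j(1)] X
      by (simp add: G0_iff GL_finitary flip: pad_mult pad_pad)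
    have T2: "mat_mult ?T h' = mat_mult (pad (k + j) X') ?T"
      using mult_Theta_rect_right[of j X' j] supp_below_mono[OF supp(2) j(2)] X
      by (simp add: G0_iff GL_finitary flip: pad_mult pad_pad)
    have supp_h': "supp_below (k + lX') h'"
      using X supp supp_below_pad by simp
    have carr: "X \<in> carrier GL_inf" "X' \<in> carrier GL_inf" "h \<in> carrier GL_inf" "h' \<in> carrier GL_inf"
        "g \<in> carrier GL_inf" "g' \<in> carrier GL_inf"
      using X g h by auto
    \<comment> \<open>\<open>h\<close> slides right through \<open>?T\<close> and past
      \<open>h'\<close> and \<open>q\<close> to join \<open>g'\<close>; \<open>h'\<close> slides
      left through \<open>?T\<close> and past \<open>p\<close> to join \<open>g\<close>. Both arrive
      padded by \<open>k + j\<close>, beyond the supports they must cross.\<close>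
    let ?g = "mat_mult g (pad (k + j) X')"
    let ?g' = "mat_mult (pad (k + j) X) g'"
    have "mat_mult h (mat_mult ?T (mat_mult h' (mat_mult q g'))) =
        mat_mult (mat_mult h ?T) (mat_mult h' (mat_mult q g'))"
      using carr q by (simp add: GL_assoc)
    also have "\<dots> = mat_mult ?T (mat_mult (pad (k + j) X) (mat_mult h' (mat_mult q g')))"
      using carr q by (simp add: T1 GL_assoc)
    also have "mat_mult (pad (k + j) X) (mat_mult h' (mat_mult q g')) =
        mat_mult h' (mat_mult q ?g')"
      using carr q j mult_pad_left_commute[OF supp_h', of "k + j" X]
        mult_pad_left_commute[OF supp(4), of "k + j" X] by simp
    also have "mat_mult ?T (mat_mult h' (mat_mult q ?g')) = mat_mult (mat_mult ?T h') (mat_mult q ?g')"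
      using carr q by (simp add: GL_assoc)
    also have "\<dots> = mat_mult (pad (k + j) X') (mat_mult ?T (mat_mult q ?g'))"
      using carr q by (simp add: T2 GL_assoc)
    finally have "rect_prod k j j (mat_mult g (mat_mult p h)) (mat_mult h' (mat_mult q g')) =
        mat_mult g (mat_mult p (mat_mult (pad (k + j) X') (mat_mult ?T (mat_mult q ?g'))))"
      using carr p q by (simp add: rect_prod_def GL_assoc)
    also have "mat_mult p (mat_mult (pad (k + j) X') (mat_mult ?T (mat_mult q ?g'))) =
        mat_mult (pad (k + j) X') (mat_mult p (mat_mult ?T (mat_mult q ?g')))"
      using carr p q j by (intro mult_pad_left_commute[OF supp(3)]) auto
    finally have "rect_prod k j j (mat_mult g (mat_mult p h)) (mat_mult h' (mat_mult q g')) =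
        mat_mult ?g (mat_mult (rect_prod k j j p q) ?g')"
      using carr p q by (simp add: rect_prod_def GL_assoc)
    moreover have "?g \<in> G n" "?g' \<in> G m"
      using subgroup.m_closed[OF subgroup_G] g pad_G[OF X(1)] pad_G[OF X(3)] j
      by (metis GL_sel(1) trans_le_add2)+
    ultimately show ?thesis
      using carr p q by (simp add: Theta_coset_eq double_coset_G_absorb)
  qed
  then show ?thesis
    unfolding eventually_sequentially
    by (intro exI[of _ "lX + lX' + lp + lq + n + m"]) auto
qed

lemma Theta_coset_eventually:
  assumes P: "P = double_coset GL_inf (G n) p (G k)" and Q: "Q = double_coset GL_inf (G k) q (G m)"
    and p: "p \<in> carrier GL_inf" "supp_below (k + b) p"
    and q: "q \<in> carrier GL_inf" "supp_below (k + a) q"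
    and le: "n \<le> k + b" "m \<le> k + a"
    and p': "p' \<in> P" and q': "q' \<in> Q"
  shows "\<forall>\<^sub>F j in sequentially.
    Theta_coset n k m p' q' j = double_coset GL_inf (G n) (rect_prod k a b p q) (G m)"
proof -
  obtain g h where 1: "g \<in> G n" "h \<in> G k" "p' = mat_mult g (mat_mult p h)"
    using p' p by (auto simp: P mem_double_coset_G_iff)
  obtain h' g' where 2: "h' \<in> G k" "g' \<in> G m" "q' = mat_mult h' (mat_mult q g')"
    using q' q by (auto simp: Q mem_double_coset_G_iff)
  \<comment> \<open>The square case \<open>j\<close>, \<open>j\<close> enlarges \<open>a\<close>,
    \<open>b\<close> by \<open>j - a\<close> and \<open>j - b\<close>; the bound on \<open>j\<close>
    makes these subtractions exact.\<close>
  have "Theta_coset n k m p q j = double_coset GL_inf (G n) (rect_prod k a b p q) (G m)"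
    if "a + b \<le> j" for j
    using double_coset_rect_prod_stable[OF p q le, of "j - a" "j - b"] that p q
    by (simp add: Theta_coset_eq)
  then have "\<forall>\<^sub>F j in sequentially.
      Theta_coset n k m p q j = double_coset GL_inf (G n) (rect_prod k a b p q) (G m)"
    unfolding eventually_sequentially by blast
  with Theta_coset_rep_change[OF p(1) q(1) 1(1) 2(2) 1(2) 2(1)] show ?thesis
    unfolding 1(3) 2(3) by eventually_elim simp
qed

lemma mem_double_coset_self:
  assumes "p \<in> carrier GL_inf"
  shows "p \<in> double_coset GL_inf (G n) p (G m)"
proof -
  have "one_mat \<in> G l" for l
    using subgroup.one_closed[OF subgroup_G[of l]] by simp
  moreover have "p = mat_mult one_mat (mat_mult p one_mat)"
    using assms GL.l_one GL.r_one by simp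
  ultimately show ?thesis
    using assms mem_double_coset_G_iff by blast
qed

text \<open>\<open>P\<close> and \<open>Q\<close> enter through equations, so that either may itself
  be a \<open>star\<close> with a known representative, as associativity requires.\<close>

lemma star_eq:
  assumes P: "P = double_coset GL_inf (G n) p (G k)" and Q: "Q = double_coset GL_inf (G k) q (G m)"
    and p: "p \<in> carrier GL_inf" "supp_below (k + b) p"
    and q: "q \<in> carrier GL_inf" "supp_below (k + a) q"
    and le: "n \<le> k + b" "m \<le> k + a"
  shows "(\<exists>!D. \<forall>p\<in>P. \<forall>q\<in>Q. eventually (\<lambda>j. Theta_coset n k m p q j = D) sequentially)"
    and "star n k m P Q = double_coset GL_inf (G n) (rect_prod k a b p q) (G m)"
proof -
  let ?ev = "\<lambda>D. \<forall>p\<in>P. \<forall>q\<in>Q. eventually (\<lambda>j. Theta_coset n k m p q j = D) sequentially"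
  let ?D = "double_coset GL_inf (G n) (rect_prod k a b p q) (G m)"
  have ev: "?ev ?D"
    using Theta_coset_eventually[OF assms] by blast
  have uniq: "D = ?D" if "?ev D" for D
  proof -
    \<comment> \<open>Uniqueness rests on having a pair of representatives: two eventual values of
      one sequence coincide.\<close>
    have "p \<in> P" "q \<in> Q"
      using p q P Q mem_double_coset_self by auto
    with that ev have "\<forall>\<^sub>F j in sequentially. Theta_coset n k m p q j = D"
      "\<forall>\<^sub>F j in sequentially. Theta_coset n k m p q j = ?D"
      by blast+
    then have "\<forall>\<^sub>F j::nat in sequentially. D = ?D"
      by eventually_elim simp
    then show ?thesis
      by simp
  qed
  show "\<exists>!D. ?ev D"
    using ev uniq by blast
  show "star n k m P Q = ?D"
    unfolding star_def using ev uniq by (rule the_equality)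
qed

section \<open>Associativity\<close>

lemma rect_prod_assoc:
  assumes N: "k \<le> N" "m \<le> N" and b: "supp_below N b"
    and carr: "a \<in> carrier GL_inf" "b \<in> carrier GL_inf" "c \<in> carrier GL_inf"
  shows "rect_prod m (N - m) (N - m + (N - k)) (rect_prod k (N - k) (N - k) a b) c =
    rect_prod k (N - k + (N - m)) (N - k) a (rect_prod m (N - m) (N - m) b c)"
proof -
  define T where "T = pad k (Theta_rect (N - k) (N - k))"
  define S where "S = pad m (Theta_rect (N - m) (N - m))"
  \<comment> \<open>The larger exchange is \<open>R S\<close> on the left side and
    \<open>T R\<close> on the right. Since \<open>R\<close> starts at \<open>N\<close>, it commutes
    with \<open>b\<close>, and both sides become \<open>a T R b S c\<close>.\<close>
  define R where "R = pad N (Theta_rect (N - m) (N - k))"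
  have TSR: "T \<in> carrier GL_inf" "S \<in> carrier GL_inf" "R \<in> carrier GL_inf"
    by (auto simp: T_def S_def R_def)
  have left: "pad m (Theta_rect (N - m) (N - m + (N - k))) = mat_mult R S"
    unfolding Theta_rect_add_right R_def S_def using N by (simp add: pad_mult pad_finitary)
  have right: "pad k (Theta_rect (N - k + (N - m)) (N - k)) = mat_mult T R"
    unfolding Theta_rect_add_left R_def T_def using N by (simp add: pad_mult pad_finitary)
  have "mat_mult b (mat_mult R (mat_mult S c)) = mat_mult R (mat_mult b (mat_mult S c))"
    unfolding R_def using carr TSR by (intro mult_pad_left_commute[OF b]) auto
  then show ?thesis
    unfolding rect_prod_def left right T_def[symmetric] S_def[symmetric]
    using carr TSR by (simp add: GL_assoc)
qed

lemma supp_below_rect_prod: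
  assumes "supp_below l p" "supp_below l q" "k + (a + b) \<le> l"
  shows "supp_below l (rect_prod k a b p q)"
  unfolding rect_prod_def
  using assms supp_below_mult supp_below_pad supp_below_Theta_rect supp_below_mono by metis

lemma double_cosets_bound:
  assumes "P \<in> double_cosets GL_inf (G n) (G m)"
  obtains p l where "p \<in> carrier GL_inf" "P = double_coset GL_inf (G n) p (G m)" "supp_below l p"
proof -
  obtain p where "p \<in> carrier GL_inf" "P = double_coset GL_inf (G n) p (G m)"
    using assms by (auto simp: double_cosets_def)
  with that show thesis
    using GL_supp_below by blast
qed

lemma star_assoc:
  assumes "A \<in> double_cosets GL_inf (G n) (G k)" "B \<in> double_cosets GL_inf (G k) (G m)"
    "C \<in> double_cosets GL_inf (G m) (G l)"
  shows "star n m l (star n k m A B) C = star n k l A (star k m l B C)"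
proof -
  obtain a la where a: "a \<in> carrier GL_inf" "A = double_coset GL_inf (G n) a (G k)" "supp_below la a"
    using assms(1) by (rule double_cosets_bound)
  obtain b lb where b: "b \<in> carrier GL_inf" "B = double_coset GL_inf (G k) b (G m)" "supp_below lb b"
    using assms(2) by (rule double_cosets_bound)
  obtain c lc where c: "c \<in> carrier GL_inf" "C = double_coset GL_inf (G m) c (G l)" "supp_below lc c"
    using assms(3) by (rule double_cosets_bound)
  define N where "N = la + lb + lc + n + k + m + l"
  have N: "n \<le> N" "k \<le> N" "m \<le> N" "l \<le> N"
    by (auto simp: N_def)
  have supp: "supp_below N a" "supp_below N b" "supp_below N c"
    using a b c supp_below_mono by (auto simp: N_def)
  have supp': "supp_below (N + (N - k)) a" "supp_below (N + (N - k)) b"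
    "supp_below (N + (N - m)) b" "supp_below (N + (N - m)) c"
    using supp supp_below_mono le_add1 by blast+
  have AB: "star n k m A B =
      double_coset GL_inf (G n) (rect_prod k (N - k) (N - k) a b) (G m)"
    using a b N supp by (intro star_eq) simp_all
  \<comment> \<open>The representative of the inner product lives below
    \<open>k + 2 * (N - k)\<close>, that is \<open>N + (N - k)\<close>, which equals
    \<open>m + (N - m + (N - k))\<close>. This dictates the second size.\<close>
  have "star n m l (star n k m A B) C = double_coset GL_inf (G n)
      (rect_prod m (N - m) (N - m + (N - k)) (rect_prod k (N - k) (N - k) a b) c) (G l)"
    using N by (intro star_eq(2)[OF AB c(2)])
      (simp_all add: a b c supp supp' supp_below_rect_prod del: Nat.add_diff_assoc)
  also have "\<dots> = double_coset GL_inf (G n)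
      (rect_prod k (N - k + (N - m)) (N - k) a (rect_prod m (N - m) (N - m) b c)) (G l)"
    by (subst rect_prod_assoc) (use N supp a b c in auto)
  also have BC: "star k m l B C =
      double_coset GL_inf (G k) (rect_prod m (N - m) (N - m) b c) (G l)"
    using b c N supp by (intro star_eq) simp_all
  \<comment> \<open>Symmetrically, the inner representative lives below \<open>N + (N - m)\<close>,
    which equals \<open>k + (N - k + (N - m))\<close>.\<close>
  have "double_coset GL_inf (G n)
      (rect_prod k (N - k + (N - m)) (N - k) a (rect_prod m (N - m) (N - m) b c)) (G l) =
      star n k l A (star k m l B C)"
    using N by (intro star_eq(2)[OF a(2) BC, symmetric])
      (simp_all add: a b c supp supp' supp_below_rect_prod del: Nat.add_diff_assoc)
  finally show ?thesis .
qed

theorem theorem1p9: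
  shows "(\<forall>n k m.
      \<forall>P \<in> double_cosets GL_inf (G n) (G k). \<forall>Q \<in> double_cosets GL_inf (G k) (G m).
        (\<exists>!D. \<forall>p\<in>P. \<forall>q\<in>Q. eventually (\<lambda>j. Theta_coset n k m p q j = D) sequentially) \<and>
        (\<forall>p\<in>P. \<forall>q\<in>Q. eventually (\<lambda>j. Theta_coset n k m p q j = star n k m P Q) sequentially) \<and>
        star n k m P Q \<in> double_cosets GL_inf (G n) (G m)) \<and>
    (\<forall>n k m l.
      \<forall>A \<in> double_cosets GL_inf (G n) (G k). \<forall>B \<in> double_cosets GL_inf (G k) (G m).
      \<forall>C \<in> double_cosets GL_inf (G m) (G l).
        star n m l (star n k m A B) C = star n k l A (star k m l B C))"
proof (intro conjI allI ballI)
  fix n k m P Q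
  assume "P \<in> double_cosets GL_inf (G n) (G k)" "Q \<in> double_cosets GL_inf (G k) (G m)"
  then obtain p lp q lq where p: "p \<in> carrier GL_inf" "P = double_coset GL_inf (G n) p (G k)"
      "supp_below lp p" and q: "q \<in> carrier GL_inf" "Q = double_coset GL_inf (G k) q (G m)"
      "supp_below lq q"
    by (meson double_cosets_bound)
  \<comment> \<open>Adding \<open>n\<close> and \<open>m\<close> to the support bounds secures the
    size conditions of \<open>star_eq\<close>.\<close>
  have bounds: "supp_below (k + (lp + n)) p" "supp_below (k + (lq + m)) q"
    "n \<le> k + (lp + n)" "m \<le> k + (lq + m)"
    using p q supp_below_mono by auto
  note star = star_eq[OF p(2) q(2) p(1) bounds(1) q(1) bounds(2-4)]
  show "\<exists>!D. \<forall>p\<in>P. \<forall>q\<in>Q. eventually (\<lambda>j. Theta_coset n k m p q j = D) sequentially"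
    by (rule star(1))
  show "star n k m P Q \<in> double_cosets GL_inf (G n) (G m)"
    unfolding star(2) double_cosets_def using p q by blast
  fix p' q'
  assume "p' \<in> P" "q' \<in> Q"
  then show "eventually (\<lambda>j. Theta_coset n k m p' q' j = star n k m P Q) sequentially"
    unfolding star(2)
    by (rule Theta_coset_eventually[OF p(2) q(2) p(1) bounds(1) q(1) bounds(2-4)])
qed (rule star_assoc)

end
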